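(* Let $\alpha\in[0,1)$, let $\varphi:\mathbb{N}\to\mathbb{N}$ be a strictly increasing map, and let $B_n\subset\mathbb{T}^{\varphi(n)+1}$ be a sequence of measurable sets. 1. Assume that for any probability distribution $\nu_1$ on $\mathbb{T}$ belonging to Case 1 or Case 2, $$\limsup_{n\to\infty}\, \mathbb{P}^*_{\nu_1}\bigl[(\eta_0,\eta_{-1},\ldots,\eta_{-\varphi(n)})\in B_n\bigr]\le \alpha.$$ Then there exists a probability distribution $\nu_2$ on $\mathbb{T}$ belonging to Case 3 such that $$\liminf_{n\to\infty}\, \mathbb{P}^*_{\nu_2}\bigl[(\eta_0,\eta_{-1},\ldots,\eta_{-\varphi(n)})\in B_n\bigr]\le \alpha.$$ 2. Assume that for any probability distribution $\nu_2$ on $\mathbb{T}$ belonging to Case 3, $$\limsup_{n\to\infty}\, \mathbb{P}^*_{\nu_2}\bigl[(\eta_0,\eta_{-1},\ldots,\eta_{-\varphi(n)})\in B_n\bigr]\le \alpha.$$ Then for all $\alpha'\in(\alpha,1)$ there exists a probability distribution $\nu_1$ on $\mathbb{T}$ belonging to Case 1 or Case 2 such that $$\liminf_{n\to\infty}\, \mathbb{P}^*_{\nu_1}\bigl[(\eta_0,\eta_{-1},\ldots,\eta_{-\varphi(n)})\in B_n\bigr]\le \alpha'.$$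
   Context: $\mathbb{N}=\{0,1,2,\ldots\}$, $-\mathbb{N}=\{0,-1,-2,\ldots\}$, and $\mathbb{T}=\mathbb{R}/\mathbb{Z}$ is the torus with its Borel $\sigma$-algebra. Probability laws $\nu$ on $\mathbb{T}$ are classified as follows. - Case 1: $\nu$ is a Dirac measure. - Case 2: the support of $\nu$ contains at least two points and there exist an integer $p\ge 2$ and $x\in\mathbb{T}$ such that the support of $\nu$ is included in $x+\{k/p : k=0,\ldots,p-1\}$. - Case 3: $\nu$ satisfies the conditions of neither Case 1 nor Case 2. For a probability law $\nu$ on $\mathbb{T}$, let $U$ and $\zeta_k$, $k\in-\mathbb{N}$, be independent $\mathbb{T}$-valued random variables such that $U$ is uniform on $\mathbb{T}$ and each $\zeta_k$ has law $\nu$. Define the process $(\eta^*_k)_{k\in-\mathbb{N}}$ by $\eta^*_0=U$ and $\eta^*_{-n}=U-\zeta_0-\zeta_{-1}-\dots-\zeta_{-n+1}$ for $n\ge 1$. Then $\mathbb{P}^*_\nu$ denotes the law of $(\eta^*_k)_{k\in-\mathbb{N}}$ on $\mathbb{T}^{-\mathbb{N}}$, and $(\eta_k)_{k\in-\mathbb{N}}$ denotes the canonical (coordinate) process on $\mathbb{T}^{-\mathbb{N}}$. *)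

theory Defs
  imports "HOL-Probability.Probability"
begin

quotient_type torus = real / "\<lambda>x y. x - y \<in> \<int>"
proof (rule equivpI)
  show "symp (\<lambda>x y :: real. x - y \<in> \<int>)"
    by (auto simp: symp_def) (metis Ints_minus minus_diff_eq)
  show "transp (\<lambda>x y :: real. x - y \<in> \<int>)"
    by (auto simp: transp_def) (metis Ints_add diff_add_cancel add_diff_eq)
qed (auto simp: reflp_def)

lift_definition to_torus :: "real \<Rightarrow> torus" is "\<lambda>x. x" .

lemma to_torus_eq_iff: "to_torus x = to_torus y \<longleftrightarrow> x - y \<in> \<int>"
  by transfer rule

lemma to_torus_cases: obtains a where "x = to_torus a"
proof -
  have "\<exists>a. x = to_torus a"
    by transfer (rule exI[of _ x for x], subst diff_self, rule Ints_0)
  then show thesis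
    using that by blast
qed

instantiation torus :: ab_group_add
begin

lift_definition zero_torus :: torus is 0 .

lift_definition plus_torus :: "torus \<Rightarrow> torus \<Rightarrow> torus" is "(+)"
  by (metis Ints_add add_diff_add)

lift_definition uminus_torus :: "torus \<Rightarrow> torus" is uminus
  by (metis Ints_minus minus_diff_eq minus_diff_minus)

definition minus_torus :: "torus \<Rightarrow> torus \<Rightarrow> torus" where
  "minus_torus x y = x + (- y)"

instance
  by standard (simp_all add: minus_torus_def, (transfer, simp)+)

end

lemma to_torus_add: "to_torus (x + y) = to_torus x + to_torus y"
  by transfer simp

lemma to_torus_minus: "to_torus (- x) = - to_torus x"
  by transfer simp

instantiation torus :: topological_space
begin

definition open_torus :: "torus set \<Rightarrow> bool" where
  "open_torus U \<longleftrightarrow> open (to_torus -` U)"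

instance
  by standard (auto simp: open_torus_def vimage_Union)

end

lemma open_to_torus_image:
  assumes "open S" shows "open (to_torus ` S)"
proof -
  have "to_torus -` to_torus ` S = (\<Union>n. (\<lambda>x. of_int n + x) ` S)"
  proof (intro set_eqI iffI)
    fix x assume "x \<in> to_torus -` to_torus ` S"
    then obtain s where "s \<in> S" "x - s \<in> \<int>"
      by (auto simp: to_torus_eq_iff)
    then obtain n where "x = of_int n + s"
      by (auto elim!: Ints_cases simp: algebra_simps)
    then show "x \<in> (\<Union>n. (\<lambda>x. of_int n + x) ` S)"
      using \<open>s \<in> S\<close> by blast
  next
    fix x assume "x \<in> (\<Union>n. (\<lambda>x. of_int n + x) ` S)"
    then obtain n s where "s \<in> S" "x = of_int n + s"
      by auto
    then have "to_torus x = to_torus s"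
      by (simp add: to_torus_eq_iff)
    then show "x \<in> to_torus -` to_torus ` S"
      using \<open>s \<in> S\<close> by auto
  qed
  moreover have "open \<dots>"
    using assms by (intro open_UN) (auto intro: open_translation)
  ultimately show ?thesis
    by (simp add: open_torus_def)
qed

lemma continuous_on_to_torus: "continuous_on UNIV to_torus"
  by (simp add: continuous_on_open_vimage open_torus_def)

instance torus :: t2_space
proof
  fix x y :: torus
  assume "x \<noteq> y"
  obtain a b where ab: "x = to_torus a" "y = to_torus b"
    by (metis to_torus_cases)
  define e where "e t = cis (2 * pi * t)" for t
  have e: "e s = e t \<longleftrightarrow> to_torus s = to_torus t" for s t
  proof -
    have "e s = e t \<longleftrightarrow> e (s - t) = 1"
      by (simp add: e_def cis_divide[symmetric] right_diff_distrib)
    also have "\<dots> \<longleftrightarrow> s - t \<in> \<int>"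
      by (auto simp: e_def complex_eq_iff cos_one_2pi_int Ints_def)
    finally show ?thesis
      by (simp add: to_torus_eq_iff)
  qed
  have cont: "continuous_on UNIV e"
    unfolding e_def by (intro continuous_intros)
  have "e a \<noteq> e b"
    using \<open>x \<noteq> y\<close> ab e by simp
  then obtain U V where UV: "open U" "open V" "e a \<in> U" "e b \<in> V" "U \<inter> V = {}"
    by (metis hausdorff)
  have "open (e -` U)" "open (e -` V)"
    using cont UV by (auto simp: open_vimage)
  then show "\<exists>U V. open U \<and> open V \<and> x \<in> U \<and> y \<in> V \<and> U \<inter> V = {}"
  proof (intro exI conjI)
    show "to_torus ` (e -` U) \<inter> to_torus ` (e -` V) = {}"
    proof (rule ccontr)
      assume "to_torus ` (e -` U) \<inter> to_torus ` (e -` V) \<noteq> {}"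
      then obtain s t where "e s \<in> U" "e t \<in> V" "to_torus s = to_torus t"
        by blast
      then show False
        using UV(5) e[of s t] by auto
    qed
  qed (use UV ab in \<open>auto intro: open_to_torus_image\<close>)
qed

instance torus :: second_countable_topology
proof
  obtain C :: "real set set" where C: "countable C" "topological_basis C"
    using ex_countable_basis by blast
  have "topological_basis ((`) to_torus ` C)"
  proof (rule topological_basisI)
    fix U and x :: torus
    assume U: "open U" "x \<in> U"
    obtain a where a: "x = to_torus a"
      by (rule to_torus_cases)
    obtain S where "S \<in> C" "a \<in> S" "S \<subseteq> to_torus -` U"
    proof (rule topological_basisE[OF C(2)])
      show "open (to_torus -` U)" "a \<in> to_torus -` U"
        using U a by (simp_all add: open_torus_def)
    qed
    then show "\<exists>B'\<in>(`) to_torus ` C. x \<in> B' \<and> B' \<subseteq> U"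
      by (intro bexI[of _ "to_torus ` S"]) (auto simp: a)
  next
    fix U :: "torus set"
    assume "U \<in> (`) to_torus ` C"
    then obtain S where "S \<in> C" "U = to_torus ` S"
      by (rule imageE)
    then show "open U"
      using topological_basis_open[OF C(2)] by (simp add: open_to_torus_image)
  qed
  moreover have "countable ((`) to_torus ` C)"
    using C by auto
  ultimately show "\<exists>B::torus set set. countable B \<and> open = generate_topology B"
    by (intro exI[of _ "(`) to_torus ` C"] conjI topological_basis_imp_subbasis)
qed

instance torus :: topological_ab_group_add
proof
  fix x y :: torus
  obtain a b where ab: "x = to_torus a" "y = to_torus b"
    by (metis to_torus_cases)
  show "((\<lambda>z. fst z + snd z) \<longlongrightarrow> x + y) (nhds x \<times>\<^sub>F nhds y)"
    unfolding tendsto_def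
  proof safe
    fix S assume S: "open S" "x + y \<in> S"
    have "open ((\<lambda>z. to_torus (fst z + snd z)) -` S)"
    proof (rule open_vimage[OF S(1)])
      show "continuous_on UNIV (\<lambda>z. to_torus (fst z + snd z))"
        by (rule continuous_on_compose2[OF continuous_on_to_torus]) (auto intro!: continuous_intros)
    qed
    moreover have "(a, b) \<in> (\<lambda>z. to_torus (fst z + snd z)) -` S"
      using S ab by (simp add: to_torus_add)
    ultimately obtain P Q where PQ: "open P" "open Q" "a \<in> P" "b \<in> Q"
      "P \<times> Q \<subseteq> (\<lambda>z. to_torus (fst z + snd z)) -` S"
      by (auto elim!: open_prod_elim)
    show "\<forall>\<^sub>F z in nhds x \<times>\<^sub>F nhds y. fst z + snd z \<in> S"
      unfolding eventually_prod_filter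
    proof (intro exI conjI)
      show "\<forall>\<^sub>F z in nhds x. z \<in> to_torus ` P" "\<forall>\<^sub>F z in nhds y. z \<in> to_torus ` Q"
        using PQ ab by (auto intro!: eventually_nhds_in_open open_to_torus_image)
      show "\<forall>u v. u \<in> to_torus ` P \<longrightarrow> v \<in> to_torus ` Q \<longrightarrow> fst (u, v) + snd (u, v) \<in> S"
        using PQ(5) by (force simp: to_torus_add[symmetric])
    qed
  qed
next
  fix x :: torus
  have "continuous_on UNIV (uminus :: torus \<Rightarrow> torus)"
  proof (subst continuous_on_open_vimage, simp, safe)
    fix S :: "torus set" assume "open S"
    moreover have "to_torus -` uminus -` S = uminus -` to_torus -` S"
      by (auto simp: to_torus_minus)
    moreover have "open (uminus -` to_torus -` S :: real set)"
    proof (rule open_vimage)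
      show "open (to_torus -` S)"
        using \<open>open S\<close> by (simp add: open_torus_def)
    qed (intro continuous_intros)
    ultimately show "open (uminus -` S \<inter> UNIV)"
      by (simp add: open_torus_def)
  qed
  then show "(uminus \<longlongrightarrow> - x) (nhds x)"
    by (simp add: continuous_on_def tendsto_at_iff_tendsto_nhds)
qed

definition torus_law :: "torus measure \<Rightarrow> bool" where
  "torus_law \<nu> \<longleftrightarrow> prob_space \<nu> \<and> sets \<nu> = sets borel"

definition law_support :: "torus measure \<Rightarrow> torus set" where
  "law_support \<nu> = {x. \<forall>U. open U \<longrightarrow> x \<in> U \<longrightarrow> emeasure \<nu> U > 0}"

definition case1 :: "torus measure \<Rightarrow> bool" where
  "case1 \<nu> \<longleftrightarrow> (\<exists>a. \<nu> = return borel a)"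

definition case2 :: "torus measure \<Rightarrow> bool" where
  "case2 \<nu> \<longleftrightarrow>
     (\<exists>a\<in>law_support \<nu>. \<exists>b\<in>law_support \<nu>. a \<noteq> b) \<and>
     (\<exists>(p::nat) x. p \<ge> 2 \<and> law_support \<nu> \<subseteq> {x + to_torus (real k / real p) | k. k < p})"

definition case3 :: "torus measure \<Rightarrow> bool" where
  "case3 \<nu> \<longleftrightarrow> \<not> case1 \<nu> \<and> \<not> case2 \<nu>"

definition torus_uniform :: "torus measure" where
  "torus_uniform = distr (uniform_measure lborel {0..<1::real}) borel to_torus"

text \<open>The index set of nonpositive integers is \<open>{..0::int}\<close>. For \<open>k = - n\<close>, the set
  \<open>{k<..0}\<close> is \<open>{-n+1, \<dots>, 0}\<close>.\<close>

definition eta_star :: "torus \<Rightarrow> (int \<Rightarrow> torus) \<Rightarrow> int \<Rightarrow> torus" where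
  "eta_star u \<zeta> = (\<lambda>k\<in>{..0}. u - (\<Sum>j\<in>{k<..0}. \<zeta> j))"

text \<open>The independent variables \<open>U\<close> and \<open>\<zeta>\<^sub>k\<close> are realised as coordinates of a product space.\<close>

definition P_star :: "torus measure \<Rightarrow> (int \<Rightarrow> torus) measure" where
  "P_star \<nu> = distr (torus_uniform \<Otimes>\<^sub>M (\<Pi>\<^sub>M k\<in>{..0::int}. \<nu>)) (\<Pi>\<^sub>M k\<in>{..0::int}. borel)
     (\<lambda>(u, \<zeta>). eta_star u \<zeta>)"

text \<open>The space of \<open>(m+1)\<close>-tuples in the torus is \<open>\<Pi>\<^sub>M i\<in>{..m}. borel\<close>, where the coordinate \<open>i\<close>
  of \<open>(\<eta>\<^sub>0, \<eta>\<^sub>-\<^sub>1, \<dots>, \<eta>\<^sub>-\<^sub>m)\<close> is \<open>\<eta>\<^sub>-\<^sub>i\<close>.\<close>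

definition past :: "nat \<Rightarrow> (int \<Rightarrow> torus) \<Rightarrow> nat \<Rightarrow> torus" where
  "past m \<eta> = (\<lambda>i\<in>{..m}. \<eta> (- int i))"

definition past_prob :: "torus measure \<Rightarrow> nat \<Rightarrow> (nat \<Rightarrow> torus) set \<Rightarrow> real" where
  "past_prob \<nu> m B = measure (P_star \<nu>) {\<eta> \<in> space (P_star \<nu>). past m \<eta> \<in> B}"

lemma to_torus_measurable [measurable]: "to_torus \<in> borel \<rightarrow>\<^sub>M borel"
  by (intro borel_measurable_continuous_onI continuous_on_to_torus)

lemma torus_law_uniform: "torus_law torus_uniform"
proof -
  interpret prob_space "uniform_measure lborel {0..<1::real}"
    by (rule prob_space_uniform_measure) auto
  show ?thesis
    unfolding torus_law_def torus_uniform_def by (auto intro!: prob_space_distr)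
qed

lemma eta_star_measurable:
  assumes "torus_law \<nu>"
  shows "(\<lambda>(u, \<zeta>). eta_star u \<zeta>) \<in>
    torus_uniform \<Otimes>\<^sub>M (\<Pi>\<^sub>M k\<in>{..0::int}. \<nu>) \<rightarrow>\<^sub>M (\<Pi>\<^sub>M k\<in>{..0::int}. borel)"
proof -
  have sets [measurable_cong]: "sets \<nu> = sets borel" "sets torus_uniform = sets borel"
    using assms torus_law_uniform by (auto simp: torus_law_def)
  have diff: "(\<lambda>x. f x - g x) \<in> borel_measurable M"
    if "f \<in> borel_measurable M" "g \<in> borel_measurable M" for f g :: "'b \<Rightarrow> torus" and M
    by (rule borel_measurable_continuous_Pair[OF that]) (intro continuous_intros)
  show ?thesis
    unfolding eta_star_def case_prod_beta
    by (intro measurable_restrict diff borel_measurable_sum) measurable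
qed

lemma prob_space_P_star:
  assumes "torus_law \<nu>" shows "prob_space (P_star \<nu>)"
proof -
  interpret U: prob_space torus_uniform
    using torus_law_uniform by (simp add: torus_law_def)
  interpret Z: prob_space "\<Pi>\<^sub>M k\<in>{..0::int}. \<nu>"
    using assms by (intro prob_space_PiM) (simp add: torus_law_def)
  interpret pair_prob_space torus_uniform "\<Pi>\<^sub>M k\<in>{..0::int}. \<nu>" ..
  show ?thesis
    unfolding P_star_def by (intro prob_space_distr eta_star_measurable assms)
qed

lemma past_measurable:
  "past m \<in> (\<Pi>\<^sub>M k\<in>{..0::int}. borel) \<rightarrow>\<^sub>M (\<Pi>\<^sub>M i\<in>{..m}. borel)"
  unfolding past_def by (intro measurable_restrict measurable_component_singleton) auto

end

theory Submission
  imports Defs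
begin

text \<open>The probability of an event depending on the first \<open>m + 1\<close> coordinates moves by at most
  \<open>m \<epsilon>\<close> when each step \<open>\<zeta>\<^sub>k\<close> is changed with probability at most \<open>\<epsilon>\<close>. So a Case 3 law can
  be obtained as a limit of Case 2 laws: start from a law on dyadic points; at stage \<open>K\<close> wait for
  a time \<open>n \<ge> K\<close> at which the event has probability almost at most \<open>\<alpha>\<close> for the current law, and
  only then move a tiny mass, negligible compared with \<open>1 / \<phi> n\<close>, to the new point
  \<open>1 / 2\<^bsup>K+2\<^esup>\<close>. The limit charges infinitely many points and still satisfies the bound along the
  chosen times. The second part is the contrapositive of this construction for the complements
  of the \<open>B\<^sub>n\<close>.\<close>

section \<open>Coordinatewise images of infinite product measures\<close>

text \<open>Both sides are finite measures, so it suffices to compare them on cylinders. There each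
  is a finite product of one-coordinate probabilities, and \<open>distr\<close> turns every factor
  into the mass of a preimage.\<close>

lemma distr_PiM_map:
  assumes M: "\<And>i. i \<in> I \<Longrightarrow> prob_space (M i)"
    and f [measurable]: "\<And>i. i \<in> I \<Longrightarrow> f i \<in> M i \<rightarrow>\<^sub>M N i"
  shows "distr (Pi\<^sub>M I M) (Pi\<^sub>M I N) (\<lambda>\<omega>. \<lambda>i\<in>I. f i (\<omega> i)) = (\<Pi>\<^sub>M i\<in>I. distr (M i) (N i) (f i))"
    (is "distr ?K _ ?t = ?I")
proof (rule measure_eqI_PiM_infinite[symmetric, OF refl])
  have D: "prob_space (distr (M i) (N i) (f i))" if "i \<in> I" for i
    using that M f by (intro prob_space.prob_space_distr) auto
  interpret prob_space ?I
    by (intro prob_space_PiM D)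
  show "finite_measure ?I"
    by unfold_locales
  have sets_eq: "sets ?I = sets (Pi\<^sub>M I N)"
    by (intro sets_PiM_cong) auto
  then show "sets (distr ?K (Pi\<^sub>M I N) ?t) = sets ?I"
    by simp
  fix A J assume J: "finite J" "J \<subseteq> I" and A: "\<And>i. i \<in> J \<Longrightarrow> A i \<in> sets (distr (M i) (N i) (f i))"
  let ?E = "prod_emb I (\<lambda>i. distr (M i) (N i) (f i)) J (Pi\<^sub>E J A)"
  have AN: "A i \<in> sets (N i)" if "i \<in> J" for i
    using A that by simp
  have fi: "f i \<in> M i \<rightarrow>\<^sub>M N i" if "i \<in> J" for i
    using that J f by auto
  have t [measurable]: "?t \<in> ?K \<rightarrow>\<^sub>M Pi\<^sub>M I N"
    by measurable
  have E: "?E \<in> sets (Pi\<^sub>M I N)"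
    unfolding sets_eq[symmetric] using J A by (intro sets_PiM_I) auto
  have "?I ?E = (\<Prod>i\<in>J. distr (M i) (N i) (f i) (A i))"
    using J A D by (intro emeasure_PiM_emb) auto
  also have "\<dots> = (\<Prod>i\<in>J. M i (f i -` A i \<inter> space (M i)))"
    using AN fi by (intro prod.cong refl emeasure_distr) auto
  also have "\<dots> = ?K (prod_emb I M J (\<Pi>\<^sub>E i\<in>J. f i -` A i \<inter> space (M i)))"
    using J AN fi by (intro emeasure_PiM_emb[symmetric] M) (auto intro!: measurable_sets)
  \<comment> \<open>A cylinder pulls back along a coordinatewise map to the cylinder over the
    pulled-back sides.\<close>
  also have "prod_emb I M J (\<Pi>\<^sub>E i\<in>J. f i -` A i \<inter> space (M i)) = ?t -` ?E \<inter> space ?K"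
    using J f[THEN measurable_space]
    by (auto simp: prod_emb_def space_PiM PiE_iff subset_eq)
  also have "?K \<dots> = distr ?K (Pi\<^sub>M I N) ?t ?E"
    by (rule emeasure_distr[OF t E, symmetric])
  finally show "?I ?E = distr ?K (Pi\<^sub>M I N) ?t ?E" .
qed

section \<open>The process driven by an image law\<close>

context
  fixes M :: "'a measure" and f :: "'a \<Rightarrow> torus"
  assumes M: "prob_space M" and f [measurable]: "f \<in> borel_measurable M"
begin

lemma torus_law_distr: "torus_law (distr M borel f)"
  using prob_space.prob_space_distr[OF M f] by (simp add: torus_law_def)

text \<open>Pushing the steps through \<open>f\<close> only at the end leaves a base space that does
  not depend on \<open>f\<close>. Two laws given by functions on the same \<open>M\<close> can thus
  be driven by the same randomness, which is what the coupling below requires.\<close>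

lemma P_star_distr:
  "P_star (distr M borel f) = distr (torus_uniform \<Otimes>\<^sub>M (\<Pi>\<^sub>M k\<in>{..0::int}. M)) (\<Pi>\<^sub>M k\<in>{..0::int}. borel)
     (\<lambda>w. eta_star (fst w) (\<lambda>j\<in>{..0}. f (snd w j)))"
proof -
  let ?N = "\<Pi>\<^sub>M k\<in>{..0::int}. M" and ?D = "\<Pi>\<^sub>M k\<in>{..0::int}. distr M borel f"
  let ?t = "\<lambda>\<omega>. \<lambda>j\<in>{..0::int}. f (\<omega> j)"
  have sD: "sets ?D = sets (\<Pi>\<^sub>M k\<in>{..0::int}. borel)"
    by (intro sets_PiM_cong) auto
  have t [measurable]: "?t \<in> ?N \<rightarrow>\<^sub>M ?D"
    by measurable
  have "distr ?N (\<Pi>\<^sub>M k\<in>{..0::int}. borel) ?t = ?D"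
    using M by (intro distr_PiM_map) auto
  \<comment> \<open>The target of \<open>distr\<close> matters only through its sigma-algebra, and
    \<open>?D\<close> has that of the Borel product.\<close>
  then have D: "distr ?N ?D ?t = ?D"
    using sD by (metis distr_cong)
  have law: "torus_law (distr M borel f)"
    by (rule torus_law_distr)
  interpret D: prob_space ?D
    using law by (intro prob_space_PiM) (auto simp: torus_law_def)
  \<comment> \<open>The uniform factor is written as its own image under the identity, so that the
    product of two images becomes the image of a product.\<close>
  have "torus_uniform \<Otimes>\<^sub>M ?D = distr torus_uniform torus_uniform (\<lambda>x. x) \<Otimes>\<^sub>M distr ?N ?D ?t"
    unfolding D by simp
  also have "\<dots> = distr (torus_uniform \<Otimes>\<^sub>M ?N) (torus_uniform \<Otimes>\<^sub>M ?D) (\<lambda>(x, y). (x, ?t y))"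
    by (rule pair_measure_distr) (use D D.sigma_finite_measure_axioms in auto)
  finally have *: "torus_uniform \<Otimes>\<^sub>M ?D =
      distr (torus_uniform \<Otimes>\<^sub>M ?N) (torus_uniform \<Otimes>\<^sub>M ?D) (\<lambda>(x, y). (x, ?t y))" .
  have "P_star (distr M borel f) =
      distr (distr (torus_uniform \<Otimes>\<^sub>M ?N) (torus_uniform \<Otimes>\<^sub>M ?D) (\<lambda>(x, y). (x, ?t y)))
        (\<Pi>\<^sub>M k\<in>{..0::int}. borel) (\<lambda>(u, \<zeta>). eta_star u \<zeta>)"
    unfolding P_star_def *[symmetric] ..
  also have "\<dots> = distr (torus_uniform \<Otimes>\<^sub>M ?N) (\<Pi>\<^sub>M k\<in>{..0::int}. borel)
      ((\<lambda>(u, \<zeta>). eta_star u \<zeta>) \<circ> (\<lambda>(x, y). (x, ?t y)))"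
    by (rule distr_distr[OF eta_star_measurable[OF law]]) measurable
  finally show ?thesis
    by (simp add: comp_def case_prod_beta)
qed

lemma eta_star_distr_measurable:
  "(\<lambda>w. eta_star (fst w) (\<lambda>j\<in>{..0}. f (snd w j)))
    \<in> torus_uniform \<Otimes>\<^sub>M (\<Pi>\<^sub>M k\<in>{..0::int}. M) \<rightarrow>\<^sub>M (\<Pi>\<^sub>M k\<in>{..0::int}. borel)"
proof -
  have "(\<lambda>w. (fst w, \<lambda>j\<in>{..0}. f (snd w j))) \<in> torus_uniform \<Otimes>\<^sub>M (\<Pi>\<^sub>M k\<in>{..0::int}. M)
      \<rightarrow>\<^sub>M torus_uniform \<Otimes>\<^sub>M (\<Pi>\<^sub>M k\<in>{..0::int}. distr M borel f)"
    by measurable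
  from measurable_compose[OF this eta_star_measurable[OF torus_law_distr]] show ?thesis
    by simp
qed

text \<open>The measurability claim accompanies the formula because the union bound in the coupling
  is applied to these events.\<close>

lemma past_prob_distr:
  assumes B: "B \<in> sets (\<Pi>\<^sub>M i\<in>{..m}. (borel :: torus measure))"
  shows "past_prob (distr M borel f) m B = measure (torus_uniform \<Otimes>\<^sub>M (\<Pi>\<^sub>M k\<in>{..0::int}. M))
     {w \<in> space (torus_uniform \<Otimes>\<^sub>M (\<Pi>\<^sub>M k\<in>{..0::int}. M)).
        past m (eta_star (fst w) (\<lambda>j\<in>{..0}. f (snd w j))) \<in> B}"
    and "{w \<in> space (torus_uniform \<Otimes>\<^sub>M (\<Pi>\<^sub>M k\<in>{..0::int}. M)).
        past m (eta_star (fst w) (\<lambda>j\<in>{..0}. f (snd w j))) \<in> B}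
      \<in> sets (torus_uniform \<Otimes>\<^sub>M (\<Pi>\<^sub>M k\<in>{..0::int}. M))"
proof -
  let ?W = "torus_uniform \<Otimes>\<^sub>M (\<Pi>\<^sub>M k\<in>{..0::int}. M)"
  let ?P = "\<Pi>\<^sub>M k\<in>{..0::int}. borel :: torus measure"
  note m = eta_star_distr_measurable
  have "{\<eta> \<in> space ?P. past m \<eta> \<in> B} = past m -` B \<inter> space ?P"
    by auto
  then have S: "{\<eta> \<in> space ?P. past m \<eta> \<in> B} \<in> sets ?P"
    using measurable_sets[OF past_measurable B] by simp
  have eq: "(\<lambda>w. eta_star (fst w) (\<lambda>j\<in>{..0}. f (snd w j))) -` {\<eta> \<in> space ?P. past m \<eta> \<in> B} \<inter> space ?W
    = {w \<in> space ?W. past m (eta_star (fst w) (\<lambda>j\<in>{..0}. f (snd w j))) \<in> B}"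
    using measurable_space[OF m] by blast
  show "past_prob (distr M borel f) m B = measure ?W
     {w \<in> space ?W. past m (eta_star (fst w) (\<lambda>j\<in>{..0}. f (snd w j))) \<in> B}"
    unfolding past_prob_def P_star_distr space_distr measure_distr[OF m S] eq ..
  show "{w \<in> space ?W. past m (eta_star (fst w) (\<lambda>j\<in>{..0}. f (snd w j))) \<in> B} \<in> sets ?W"
    using measurable_sets[OF m S] unfolding eq .
qed

end

section \<open>Coupling two laws, and complements of events\<close>

text \<open>The variable \<open>\<eta>\<close> at time \<open>- i\<close> sums the steps with index
  in \<open>{- i<..0}\<close>. For \<open>i \<le> m\<close> these all lie in
  \<open>{- m<..0}\<close>, so exactly \<open>m\<close> steps matter; this is the source of the
  factor \<open>m\<close> in the coupling bound.\<close>

lemma past_eta_star_cong: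
  assumes "\<And>j. - int m < j \<Longrightarrow> j \<le> 0 \<Longrightarrow> \<zeta> j = \<zeta>' j"
  shows "past m (eta_star u \<zeta>) = past m (eta_star u \<zeta>')"
  unfolding past_def eta_star_def
  by (intro restrict_ext) (auto intro!: sum.cong assms)

text \<open>Both processes use the same starting point and the same sample in \<open>M\<close> for
  each step. Their pasts can differ only if one of the \<open>m\<close> relevant samples falls in
  \<open>S\<close>; each does so with probability \<open>measure M S\<close>, and a union bound
  concludes.\<close>

lemma past_prob_coupling:
  assumes M: "prob_space M" and f: "f \<in> borel_measurable M" and g: "g \<in> borel_measurable M"
    and S [measurable]: "S \<in> sets M" and eq: "\<And>x. x \<in> space M - S \<Longrightarrow> f x = g x"
    and B: "B \<in> sets (\<Pi>\<^sub>M i\<in>{..m}. (borel :: torus measure))"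
  shows "past_prob (distr M borel f) m B \<le> past_prob (distr M borel g) m B + real m * measure M S"
proof -
  let ?N = "\<Pi>\<^sub>M k\<in>{..0::int}. M"
  let ?W = "torus_uniform \<Otimes>\<^sub>M ?N"
  let ?E = "\<lambda>f. {w \<in> space ?W. past m (eta_star (fst w) (\<lambda>j\<in>{..0}. f (snd w j))) \<in> B}"
  let ?F = "\<lambda>j. {w \<in> space ?W. snd w j \<in> S}"
  interpret U: prob_space torus_uniform
    using torus_law_uniform by (simp add: torus_law_def)
  interpret N: prob_space ?N
    using M by (intro prob_space_PiM)
  interpret pair_prob_space torus_uniform ?N ..
  have F: "?F j \<in> sets ?W" if "j \<in> {- int m<..0}" for j
  proof -
    have "j \<in> {..0}"
      using that by auto
    then show ?thesis
      by measurable
  qed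
  have mF: "measure ?W (?F j) = measure M S" if "j \<in> {- int m<..0}" for j
  proof -
    have j: "j \<in> {..0::int}"
      using that by auto
    have "?F j = space torus_uniform \<times> ((\<lambda>\<omega>. \<omega> j) -` S \<inter> space ?N)"
      by (auto simp: space_pair_measure)
    moreover have "(\<lambda>\<omega>. \<omega> j) -` S \<inter> space ?N \<in> sets ?N"
      using j by measurable
    ultimately have "measure ?W (?F j) = measure ?N ((\<lambda>\<omega>. \<omega> j) -` S \<inter> space ?N)"
      by (simp add: measure_def N.emeasure_pair_measure_Times U.emeasure_space_1)
    also have "\<dots> = measure (distr ?N M (\<lambda>\<omega>. \<omega> j)) S"
      using j by (intro measure_distr[symmetric]) auto
    also have "distr ?N M (\<lambda>\<omega>. \<omega> j) = M"
      using M j by (intro distr_PiM_component) auto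
    finally show ?thesis .
  qed
  \<comment> \<open>Outside the union of the \<open>?F j\<close> all relevant steps agree under
    \<open>f\<close> and \<open>g\<close>, hence so do the pasts.\<close>
  have sub: "?E f \<subseteq> ?E g \<union> (\<Union>j\<in>{- int m<..0}. ?F j)"
  proof
    fix w assume w: "w \<in> ?E f"
    show "w \<in> ?E g \<union> (\<Union>j\<in>{- int m<..0}. ?F j)"
    proof (cases "\<exists>j\<in>{- int m<..0}. snd w j \<in> S")
      case True
      then show ?thesis using w by auto
    next
      case False
      have "snd w j \<in> space M" if "j \<le> 0" for j
        using w that by (auto simp: space_pair_measure space_PiM PiE_iff)
      then have "past m (eta_star (fst w) (\<lambda>j\<in>{..0}. f (snd w j)))
          = past m (eta_star (fst w) (\<lambda>j\<in>{..0}. g (snd w j)))"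
        using False eq by (intro past_eta_star_cong) auto
      then show ?thesis using w by auto
    qed
  qed
  have Eg: "?E g \<in> sets ?W"
    by (rule past_prob_distr(2)[OF M g B])
  have UF: "(\<Union>j\<in>{- int m<..0}. ?F j) \<in> sets ?W"
    using F by (intro sets.finite_UN) auto
  have "measure ?W (?E f) \<le> measure ?W (?E g \<union> (\<Union>j\<in>{- int m<..0}. ?F j))"
    using sub Eg UF by (intro P.finite_measure_mono) auto
  also have "\<dots> \<le> measure ?W (?E g) + measure ?W (\<Union>j\<in>{- int m<..0}. ?F j)"
    using Eg UF by (rule measure_Un_le)
  finally have "measure ?W (?E f) \<le> measure ?W (?E g) + measure ?W (\<Union>j\<in>{- int m<..0}. ?F j)" .
  moreover have "measure ?W (\<Union>j\<in>{- int m<..0}. ?F j) \<le> (\<Sum>j\<in>{- int m<..0}. measure ?W (?F j))"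
    using F by (intro P.finite_measure_subadditive_finite) auto
  moreover have "(\<Sum>j\<in>{- int m<..0}. measure ?W (?F j)) = real m * measure M S"
    using mF by simp
  ultimately show ?thesis
    unfolding past_prob_distr(1)[OF M f B] past_prob_distr(1)[OF M g B] by linarith
qed

text \<open>This exchanges upper bounds for an event with lower bounds for its complement, as the
  second half of the theorem requires.\<close>

lemma past_prob_Compl:
  assumes law: "torus_law \<nu>" and B: "B \<in> sets (\<Pi>\<^sub>M i\<in>{..m}. (borel :: torus measure))"
  shows "past_prob \<nu> m (space (\<Pi>\<^sub>M i\<in>{..m}. (borel :: torus measure)) - B) = 1 - past_prob \<nu> m B"
proof -
  let ?Q = "\<Pi>\<^sub>M i\<in>{..m}. (borel :: torus measure)"
  interpret prob_space "P_star \<nu>"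
    by (rule prob_space_P_star[OF law])
  have m: "past m \<in> P_star \<nu> \<rightarrow>\<^sub>M ?Q"
    using past_measurable by (simp add: P_star_def)
  have "{\<eta> \<in> space (P_star \<nu>). past m \<eta> \<in> space ?Q - B}
      = space (P_star \<nu>) - {\<eta> \<in> space (P_star \<nu>). past m \<eta> \<in> B}"
    using measurable_space[OF m] by auto
  moreover have "{\<eta> \<in> space (P_star \<nu>). past m \<eta> \<in> B} = past m -` B \<inter> space (P_star \<nu>)"
    by auto
  then have "{\<eta> \<in> space (P_star \<nu>). past m \<eta> \<in> B} \<in> sets (P_star \<nu>)"
    using measurable_sets[OF m B] by simp
  ultimately show ?thesis
    unfolding past_prob_def by (simp add: prob_compl)
qed

section \<open>Supports of image laws\<close>

text \<open>The complement of \<open>F\<close> is an open set of mass zero, so none of its points is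
  in the support.\<close>

lemma law_support_distr_subset:
  assumes f: "f \<in> borel_measurable M" and F: "closed F" "\<And>x. x \<in> space M \<Longrightarrow> f x \<in> F"
  shows "law_support (distr M borel f) \<subseteq> F"
proof
  fix y assume y: "y \<in> law_support (distr M borel f)"
  show "y \<in> F"
  proof (rule ccontr)
    assume "y \<notin> F"
    with y F(1) have "emeasure (distr M borel f) (- F) > 0"
      by (auto simp: law_support_def open_Compl)
    moreover have "f -` (- F) \<inter> space M = {}"
      using F(2) by auto
    ultimately show False
      using F(1) f by (simp add: emeasure_distr open_Compl)
  qed
qed

lemma law_support_distr_atom:
  assumes f: "f \<in> borel_measurable M" and A: "A \<in> sets M" "emeasure M A > 0" "\<And>x. x \<in> A \<Longrightarrow> f x = y"
  shows "y \<in> law_support (distr M borel f)"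
  unfolding law_support_def
proof (intro CollectI allI impI)
  fix U :: "torus set" assume U: "open U" "y \<in> U"
  have "0 < emeasure M A" by fact
  also have "\<dots> \<le> emeasure M (f -` U \<inter> space M)"
    using U f A sets.sets_into_space[OF A(1)]
    by (intro emeasure_mono) (auto intro: measurable_sets)
  also have "\<dots> = emeasure (distr M borel f) U"
    using U f by (simp add: emeasure_distr)
  finally show "emeasure (distr M borel f) U > 0" .
qed

lemma law_support_return: "law_support (return borel a) \<subseteq> {a}"
proof
  fix y assume y: "y \<in> law_support (return borel a)"
  show "y \<in> {a}"
  proof (rule ccontr)
    assume "y \<notin> {a}"
    with y have "emeasure (return borel a) (- {a}) > 0"
      by (auto simp: law_support_def open_Compl)
    then show False by simp
  qed
qed

text \<open>A Dirac law has at most one support point and a Case 2 law at most \<open>p\<close>, so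
  an infinite support excludes both.\<close>

lemma case3_if_infinite_support:
  assumes "infinite (law_support \<nu>)"
  shows "case3 \<nu>"
  unfolding case3_def case1_def case2_def
proof (intro conjI notI)
  assume "\<exists>a. \<nu> = return borel a"
  then show False
    using assms law_support_return finite_subset by blast
next
  assume "(\<exists>a\<in>law_support \<nu>. \<exists>b\<in>law_support \<nu>. a \<noteq> b) \<and>
     (\<exists>(p::nat) x. p \<ge> 2 \<and> law_support \<nu> \<subseteq> {x + to_torus (real k / real p) | k. k < p})"
  then obtain p :: nat and x where "law_support \<nu> \<subseteq> {x + to_torus (real k / real p) | k. k < p}"
    by blast
  moreover have "{x + to_torus (real k / real p) | k. k < p} = (\<lambda>k. x + to_torus (real k / real p)) ` {..<p}"
    by auto
  ultimately have "finite (law_support \<nu>)"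
    by (metis finite_imageI finite_lessThan finite_subset)
  then show False
    using assms by simp
qed

section \<open>Lebesgue measure on the unit interval, and dyadic points of the torus\<close>

abbreviation unit_interval_measure :: "real measure" where
  "unit_interval_measure \<equiv> uniform_measure lborel {0..<1}"

lemma prob_space_unit_interval: "prob_space unit_interval_measure"
  by (rule prob_space_uniform_measure) auto

lemma emeasure_unit_interval_subinterval:
  assumes "0 \<le> s" "s \<le> t" "t \<le> 1"
  shows "emeasure unit_interval_measure {s..<t} = ennreal (t - s)"
proof -
  have "{0..<1} \<inter> {s..<t} = {s..<t}"
    using assms by auto
  then show ?thesis
    using assms by (simp add: divide_ennreal_def)
qed

lemma emeasure_unit_interval_subinterval_pos:
  assumes "0 \<le> s" "s < t" "t \<le> 1"
  shows "emeasure unit_interval_measure {s..<t} > 0"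
  using emeasure_unit_interval_subinterval[of s t] assms by (simp del: emeasure_uniform_measure)

lemma measure_unit_interval_lessThan:
  assumes "0 \<le> t" "t \<le> 1"
  shows "measure unit_interval_measure {..<t} = t"
proof -
  have "{0..<1} \<inter> {..<t} = {0..<t}"
    using assms by auto
  then have "emeasure unit_interval_measure {..<t} = ennreal t"
    using assms by (simp add: divide_ennreal_def)
  then show ?thesis
    using assms by (simp only: measure_def enn2real_ennreal)
qed

text \<open>All representatives lie in \<open>(0, 1/2]\<close>, so two of them differ by less than 1
  and an integer difference must vanish.\<close>

lemma to_torus_dyadic_inj: "inj (\<lambda>k. to_torus (1 / 2 ^ Suc k))"
proof (rule injI)
  fix j k :: nat
  assume "to_torus (1 / 2 ^ Suc j) = to_torus (1 / 2 ^ Suc k)"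
  then obtain n where n: "1 / 2 ^ Suc j - 1 / 2 ^ Suc k = (of_int n :: real)"
    by (auto simp: to_torus_eq_iff elim!: Ints_cases)
  have "0 < (1 / 2 ^ Suc i :: real)" "1 / 2 ^ Suc i \<le> (1/2 :: real)" for i
    by (auto simp: field_simps)
  from this[of j] this[of k] n have "(of_int n :: real) < 1" "(of_int n :: real) > -1"
    by linarith+
  then have "n = 0" by linarith
  with n have "(2::real) ^ j = 2 ^ k" by simp
  then show "j = k" by simp
qed

lemma to_torus_dyadic_neq_0: "to_torus (1 / 2 ^ Suc k) \<noteq> to_torus 0"
proof
  assume "to_torus (1 / 2 ^ Suc k) = to_torus 0"
  then obtain n where n: "1 / 2 ^ Suc k = (of_int n :: real)"
    by (auto simp: to_torus_eq_iff elim!: Ints_cases)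
  have "0 < (1 / 2 ^ Suc k :: real)" "1 / 2 ^ Suc k \<le> (1/2 :: real)"
    by (auto simp: field_simps)
  with n have "(of_int n :: real) < 1" "(of_int n :: real) > 0"
    by linarith+
  then show False
    by (simp only: of_int_less_1_iff of_int_0_less_iff)
qed

section \<open>Step functions with dyadic values\<close>

abbreviation unit_law :: "(real \<Rightarrow> real) \<Rightarrow> torus measure" where
  "unit_law g \<equiv> distr unit_interval_measure borel (\<lambda>v. to_torus (g v))"

text \<open>Laws are realised as images of Lebesgue measure on \<open>[0, 1)\<close> under step functions \<open>g\<close>. The
  later modifications of \<open>g\<close> happen only on \<open>{..<t}\<close>, where the value is the most recent point.\<close>

definition dyadic_stage :: "nat \<Rightarrow> real \<Rightarrow> (real \<Rightarrow> real) \<Rightarrow> bool" where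
  "dyadic_stage K t g \<longleftrightarrow> 0 < t \<and> t \<le> 1/2 \<and> g \<in> borel_measurable borel \<and>
     (\<forall>v<t. g v = 1 / 2 ^ Suc K) \<and> (\<forall>v\<ge>1/2. g v = 0) \<and>
     range g \<subseteq> insert 0 ((\<lambda>k. 1 / 2 ^ Suc k) ` {..K})"

text \<open>The points 0 and \<open>1 / 2 ^ Suc K\<close> are charged by \<open>{1/2..<1}\<close>
  and \<open>{0..<t}\<close>. All values of \<open>g\<close> are multiples of
  \<open>1 / 2 ^ Suc K\<close>, so \<open>p = 2 ^ Suc K\<close> with base point 0 witnesses Case
  2.\<close>

lemma dyadic_stage_law:
  assumes "dyadic_stage K t g"
  shows "torus_law (unit_law g)" "case2 (unit_law g)"
proof -
  have t: "0 < t" "t \<le> 1/2" and g [measurable]: "g \<in> borel_measurable borel"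
    and lo: "\<And>v. v < t \<Longrightarrow> g v = 1 / 2 ^ Suc K" and hi: "\<And>v. v \<ge> 1/2 \<Longrightarrow> g v = 0"
    and rg: "range g \<subseteq> insert 0 ((\<lambda>k. 1 / 2 ^ Suc k) ` {..K})"
    using assms by (auto simp: dyadic_stage_def)
  have m: "(\<lambda>v. to_torus (g v)) \<in> borel_measurable unit_interval_measure"
    by measurable
  show "torus_law (unit_law g)"
    by (rule torus_law_distr[OF prob_space_unit_interval m])
  let ?S = "law_support (unit_law g)"
  have "to_torus 0 \<in> ?S"
  proof (rule law_support_distr_atom[OF m])
    show "emeasure unit_interval_measure {1/2..<1} > 0"
      by (rule emeasure_unit_interval_subinterval_pos) auto
  qed (auto simp: hi)
  moreover have "to_torus (1 / 2 ^ Suc K) \<in> ?S"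
  proof (rule law_support_distr_atom[OF m])
    show "emeasure unit_interval_measure {0..<t} > 0"
      using t by (intro emeasure_unit_interval_subinterval_pos) auto
  qed (auto simp: lo)
  moreover have "?S \<subseteq> {0 + to_torus (real k / real (2 ^ Suc K)) | k. k < 2 ^ Suc K}" (is "_ \<subseteq> ?F")
  proof (rule law_support_distr_subset[OF m])
    have "?F = (\<lambda>k. 0 + to_torus (real k / real (2 ^ Suc K))) ` {..<2 ^ Suc K}"
      by auto
    then have "finite ?F"
      by simp
    then show "closed ?F"
      by (rule finite_imp_closed)
    fix v
    consider "g v = 0" | k where "k \<le> K" "g v = 1 / 2 ^ Suc k"
      using rg by blast
    then show "to_torus (g v) \<in> ?F"
    proof cases
      case 1
      then have "to_torus (g v) = 0 + to_torus (real 0 / real (2 ^ Suc K))"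
        by simp
      then show ?thesis
        by (intro CollectI exI[of _ 0]) auto
    next
      case 2
      \<comment> \<open>Earlier dyadic values are rewritten over the common denominator
        \<open>2 ^ Suc K\<close>.\<close>
      have "g v = real (2 ^ (K - k)) / real (2 ^ Suc K)"
        using 2 power_add[of "2::real" "K - k" k] by simp
      moreover have "(2::nat) ^ (K - k) < 2 ^ Suc K"
        by (rule power_strict_increasing) auto
      ultimately show ?thesis
        by (intro CollectI exI[of _ "2 ^ (K - k)"]) auto
    qed
  qed
  ultimately show "case2 (unit_law g)"
    unfolding case2_def
  proof (intro conjI)
    assume "to_torus 0 \<in> ?S" "to_torus (1 / 2 ^ Suc K) \<in> ?S"
    then show "\<exists>a\<in>?S. \<exists>b\<in>?S. a \<noteq> b"
      using to_torus_dyadic_neq_0[of K] by blast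
  next
    assume "?S \<subseteq> ?F"
    moreover have "(2::nat) ^ Suc K \<ge> 2"
      by simp
    ultimately show "\<exists>(p::nat) x. p \<ge> 2 \<and> ?S \<subseteq> {x + to_torus (real k / real p) | k. k < p}"
      by (intro exI conjI)
  qed
qed

text \<open>The starting law is a fair coin on 0 and \<open>1/2\<close>. Its upper half
  \<open>{1/2..<1}\<close> is never modified, so 0 stays charged at every stage.\<close>

lemma dyadic_stage_0: "dyadic_stage 0 (1/2) (\<lambda>v. if v < 1/2 then 1/2 else 0)"
  by (auto simp: dyadic_stage_def)

lemma dyadic_stage_Suc:
  assumes st: "dyadic_stage K t g" and t': "0 < t'" "t' < t"
  shows "dyadic_stage (Suc K) t' (\<lambda>v. if v < t' then 1 / 2 ^ Suc (Suc K) else g v)"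
  unfolding dyadic_stage_def
proof (intro conjI)
  have [measurable]: "g \<in> borel_measurable borel"
    using st by (simp add: dyadic_stage_def)
  show "(\<lambda>v. if v < t' then 1 / 2 ^ Suc (Suc K) else g v) \<in> borel_measurable borel"
    by measurable
  have rg: "g v \<in> insert 0 ((\<lambda>k. 1 / 2 ^ Suc k) ` {..K})" for v
    using st unfolding dyadic_stage_def by blast
  show "range (\<lambda>v. if v < t' then 1 / 2 ^ Suc (Suc K) else g v)
      \<subseteq> insert 0 ((\<lambda>k. 1 / 2 ^ Suc k) ` {..Suc K})"
    unfolding atMost_Suc image_insert using rg by (intro image_subsetI) (auto simp del: power_Suc)
  show "t' \<le> 1/2" "\<forall>v\<ge>1/2. (if v < t' then 1 / 2 ^ Suc (Suc K) else g v) = 0"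
    using assms unfolding dyadic_stage_def by (simp_all del: power_Suc)
qed (use t' in simp_all)

section \<open>The limit law\<close>

text \<open>The hypothesis is applied to every stage of the recursion, since each stage is a Case 2
  law. The bound is a general \<open>\<beta>\<close> and the sets are arbitrary, so that the lemma
  serves both for the \<open>B n\<close> and for their complements.\<close>

lemma case3_law_exists:
  fixes \<beta> :: real
  assumes B: "\<And>n. B n \<in> sets (\<Pi>\<^sub>M i\<in>{..\<phi> n}. (borel :: torus measure))"
    and lim: "\<And>\<nu>. torus_law \<nu> \<Longrightarrow> case2 \<nu> \<Longrightarrow>
      limsup (\<lambda>n. ereal (past_prob \<nu> (\<phi> n) (B n))) \<le> ereal \<beta>"
  obtains \<nu> where "torus_law \<nu>" "case3 \<nu>" "liminf (\<lambda>n. ereal (past_prob \<nu> (\<phi> n) (B n))) \<le> ereal \<beta>"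
proof -
  let ?P = "\<lambda>K (t, g). dyadic_stage K t g"
  \<comment> \<open>The time \<open>n\<close> is a good one for the old function \<open>g\<close>,
    while the new threshold \<open>t'\<close> is small relative to \<open>\<phi> n\<close>. All
    later changes stay inside \<open>{..<t'}\<close>, so together they cost at most
    \<open>1 / Suc K\<close> at time \<open>n\<close>.\<close>
  let ?Q = "\<lambda>K (t, g) (t', g'). t' < t \<and> (\<forall>v\<ge>t'. g' v = g v) \<and>
    (\<exists>n\<ge>K. past_prob (unit_law g) (\<phi> n) (B n) \<le> \<beta> + 1 / Suc K \<and> real (\<phi> n) * t' \<le> 1 / Suc K)"
  have "\<exists>h. \<forall>K. ?P K (h K) \<and> ?Q K (h K) (h (Suc K))"
  proof (rule dependent_nat_choice)
    show "\<exists>x. ?P 0 x"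
      using dyadic_stage_0 by auto
  next
    fix x :: "real \<times> (real \<Rightarrow> real)" and K
    assume x: "?P K x"
    obtain t g where tg: "x = (t, g)" by (cases x)
    have st: "dyadic_stage K t g" using x tg by simp
    \<comment> \<open>The slack \<open>1 / Suc K\<close> makes the inequality strict, so the bound
      holds for all large \<open>n\<close>, in particular for some \<open>n \<ge> K\<close>.\<close>
    have "limsup (\<lambda>n. ereal (past_prob (unit_law g) (\<phi> n) (B n))) < ereal (\<beta> + 1 / Suc K)"
      using lim[OF dyadic_stage_law[OF st]] by (rule le_less_trans) simp
    then have "\<forall>\<^sub>F n in sequentially. ereal (past_prob (unit_law g) (\<phi> n) (B n)) < ereal (\<beta> + 1 / Suc K)"
      by (rule Limsup_lessD)
    then obtain n where n: "n \<ge> K" "past_prob (unit_law g) (\<phi> n) (B n) < \<beta> + 1 / Suc K"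
      by (auto simp: eventually_sequentially) (meson nat_le_linear)
    \<comment> \<open>The term \<open>t / 2\<close> makes the thresholds strictly decrease, leaving
      positive mass on the previous point; the other term bounds the coupling cost.
      \<open>Suc (\<phi> n)\<close> keeps the denominator positive when
      \<open>\<phi> n = 0\<close>.\<close>
    define t' where "t' = min (t / 2) (1 / (real (Suc K) * real (Suc (\<phi> n))))"
    define g' where "g' v = (if v < t' then 1 / 2 ^ Suc (Suc K) else g v)" for v
    have t: "0 < t" using st by (simp add: dyadic_stage_def)
    have t': "0 < t'" "t' < t"
      using t by (auto simp: t'_def simp del: of_nat_Suc)
    have "real (\<phi> n) * t' \<le> real (Suc (\<phi> n)) * (1 / (real (Suc K) * real (Suc (\<phi> n))))"
      using t' by (intro mult_mono) (auto simp: t'_def simp del: of_nat_Suc)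
    also have "\<dots> = 1 / Suc K"
      by (simp del: of_nat_Suc)
    finally have "real (\<phi> n) * t' \<le> 1 / Suc K" .
    with n have "\<exists>n\<ge>K. past_prob (unit_law g) (\<phi> n) (B n) \<le> \<beta> + 1 / Suc K \<and> real (\<phi> n) * t' \<le> 1 / Suc K"
      by (intro exI[of _ n] conjI) simp_all
    moreover have "\<forall>v\<ge>t'. g' v = g v"
      by (simp add: g'_def)
    ultimately have Q: "?Q K x (t', g')"
      unfolding tg prod.case using t' by (intro conjI)
    have "?P (Suc K) (t', g')"
      unfolding prod.case g'_def using dyadic_stage_Suc[OF st t'] .
    with Q show "\<exists>y. ?P (Suc K) y \<and> ?Q K x y"
      by (intro exI[of _ "(t', g')"] conjI)
  qed
  then obtain h where h: "\<forall>K. ?P K (h K) \<and> ?Q K (h K) (h (Suc K))"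
    by (rule exE)
  define t where "t K = fst (h K)" for K
  define g where "g K = snd (h K)" for K
  have st: "dyadic_stage K (t K) (g K)" for K
    using h[rule_format, of K, THEN conjunct1] by (simp add: t_def g_def case_prod_beta)
  have t_less: "t (Suc K) < t K" and g_Suc: "v \<ge> t (Suc K) \<Longrightarrow> g (Suc K) v = g K v"
    and ex: "\<exists>n\<ge>K. past_prob (unit_law (g K)) (\<phi> n) (B n) \<le> \<beta> + 1 / Suc K
      \<and> real (\<phi> n) * t (Suc K) \<le> 1 / Suc K" for K v
    using h[rule_format, of K, THEN conjunct2] unfolding t_def g_def case_prod_beta by blast+
  have t_bd: "0 < t K" "t K \<le> 1/2" for K
    using st[of K] by (auto simp: dyadic_stage_def)
  have g_meas [measurable]: "g K \<in> borel_measurable borel" for K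
    using st[of K] by (auto simp: dyadic_stage_def)
  have t_mono: "decseq t"
    using t_less by (intro decseq_SucI) (simp add: less_imp_le)
  have g_stable: "g j v = g K v" if "j \<ge> K" "v \<ge> t (Suc K)" for j K v
    using that(1)
  proof (induction j rule: dec_induct)
    case (step j)
    then have "t (Suc j) \<le> t (Suc K)"
      using t_mono by (auto simp: decseq_def)
    then show ?case
      using step g_Suc that(2) by auto
  qed simp
  \<comment> \<open>For \<open>v > 0\<close> with \<open>v\<close> above some threshold the sequence
    is eventually constant. Taking \<open>lim\<close> gives measurability at once.\<close>
  define G where "G v = lim (\<lambda>K. g K v)" for v
  have [measurable]: "G \<in> borel_measurable borel"
    unfolding G_def by (rule borel_measurable_lim_metric) simp
  have G_eq: "G v = g K v" if "v \<ge> t (Suc K)" for K v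
    unfolding G_def
    by (intro limI tendsto_eventually eventually_sequentiallyI[of K] g_stable that)
  have m: "(\<lambda>v. to_torus (G v)) \<in> borel_measurable unit_interval_measure"
    and mK: "(\<lambda>v. to_torus (g K v)) \<in> borel_measurable unit_interval_measure" for K
    by measurable
  show ?thesis
  proof (rule that)
    show "torus_law (unit_law G)"
      by (rule torus_law_distr[OF prob_space_unit_interval m])
    \<comment> \<open>On \<open>{t (Suc K)..<t K}\<close> the limit equals \<open>g K\<close>, which
      there still has the value introduced at stage \<open>K\<close>. Hence every dyadic point is an
      atom, and the support is infinite.\<close>
    have "to_torus (1 / 2 ^ Suc K) \<in> law_support (unit_law G)" for K
    proof (rule law_support_distr_atom[OF m])
      show "emeasure unit_interval_measure {t (Suc K)..<t K} > 0"
        using t_bd[of K] t_bd[of "Suc K"] t_less[of K]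
        by (intro emeasure_unit_interval_subinterval_pos) auto
      show "to_torus (G v) = to_torus (1 / 2 ^ Suc K)" if "v \<in> {t (Suc K)..<t K}" for v
        using that G_eq[of K v] st[of K] by (auto simp: dyadic_stage_def)
    qed simp
    then have "range (\<lambda>K. to_torus (1 / 2 ^ Suc K)) \<subseteq> law_support (unit_law G)"
      by auto
    then show "case3 (unit_law G)"
      using range_inj_infinite[OF to_torus_dyadic_inj] finite_subset
      by (intro case3_if_infinite_support) blast
    have near: "\<exists>n\<ge>K. past_prob (unit_law G) (\<phi> n) (B n) \<le> \<beta> + 2 / Suc K" for K
    proof -
      obtain n where n: "n \<ge> K" "past_prob (unit_law (g K)) (\<phi> n) (B n) \<le> \<beta> + 1 / Suc K"
        "real (\<phi> n) * t (Suc K) \<le> 1 / Suc K"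
        using ex by blast
      \<comment> \<open>\<open>G\<close> and \<open>g K\<close> can differ only on
        \<open>{..<t (Suc K)}\<close>, so a single coupling accounts for all later stages.\<close>
      have "past_prob (unit_law G) (\<phi> n) (B n)
          \<le> past_prob (unit_law (g K)) (\<phi> n) (B n)
            + real (\<phi> n) * measure unit_interval_measure {..<t (Suc K)}"
        using G_eq[of K] by (intro past_prob_coupling[OF prob_space_unit_interval m mK _ _ B]) auto
      also have "measure unit_interval_measure {..<t (Suc K)} = t (Suc K)"
        using t_bd[of "Suc K"] by (intro measure_unit_interval_lessThan) linarith+
      finally have "past_prob (unit_law G) (\<phi> n) (B n) \<le> \<beta> + (1 / Suc K + 1 / Suc K)"
        using n by linarith
      also have "1 / Suc K + 1 / Suc K = 2 / real (Suc K)"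
        by (simp del: of_nat_Suc)
      finally show ?thesis
        using n(1) by blast
    qed
    show "liminf (\<lambda>n. ereal (past_prob (unit_law G) (\<phi> n) (B n))) \<le> ereal \<beta>"
    proof (rule ccontr)
      assume "\<not> ?thesis"
      \<comment> \<open>A value \<open>c\<close> strictly between \<open>\<beta>\<close> and the
        lower limit would be exceeded at all late times, whereas \<open>near\<close> supplies
        arbitrarily late times with bound \<open>\<beta> + 2 / Suc K\<close>, below \<open>c\<close>
        for large \<open>K\<close>.\<close>
      then obtain c where c: "ereal \<beta> < ereal c" "ereal c < liminf (\<lambda>n. ereal (past_prob (unit_law G) (\<phi> n) (B n)))"
        using ereal_dense2[of "ereal \<beta>"] by (auto simp: not_le)
      then have "\<forall>\<^sub>F n in sequentially. ereal c < ereal (past_prob (unit_law G) (\<phi> n) (B n))"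
        using less_LiminfD by blast
      then obtain N where N: "\<And>n. n \<ge> N \<Longrightarrow> c < past_prob (unit_law G) (\<phi> n) (B n)"
        by (auto simp: eventually_sequentially)
      obtain K0 where K0: "inverse (real (Suc K0)) < (c - \<beta>) / 2"
        using reals_Archimedean[of "(c - \<beta>) / 2"] c by auto
      define K where "K = max N K0"
      have "inverse (real (Suc K)) \<le> inverse (real (Suc K0))"
        by (intro le_imp_inverse_le) (auto simp: K_def)
      with K0 have "\<beta> + 2 / Suc K < c"
        by (simp add: inverse_eq_divide)
      moreover obtain n where "n \<ge> K" "past_prob (unit_law G) (\<phi> n) (B n) \<le> \<beta> + 2 / Suc K"
        using near by blast
      ultimately show False
        using N[of n] by (simp add: K_def)
    qed
  qed
qed

section \<open>The two implications, the second by passing to complements\<close>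

theorem corollary1:
  fixes \<alpha> :: real and \<phi> :: "nat \<Rightarrow> nat" and B :: "nat \<Rightarrow> (nat \<Rightarrow> torus) set"
  assumes "0 \<le> \<alpha>" and "\<alpha> < 1" and "strict_mono \<phi>"
    and "\<And>n. B n \<in> sets (\<Pi>\<^sub>M i\<in>{..\<phi> n}. (borel :: torus measure))"
  shows
    "((\<forall>\<nu>\<^sub>1. torus_law \<nu>\<^sub>1 \<and> (case1 \<nu>\<^sub>1 \<or> case2 \<nu>\<^sub>1) \<longrightarrow>
          limsup (\<lambda>n. ereal (past_prob \<nu>\<^sub>1 (\<phi> n) (B n))) \<le> ereal \<alpha>) \<longrightarrow>
      (\<exists>\<nu>\<^sub>2. torus_law \<nu>\<^sub>2 \<and> case3 \<nu>\<^sub>2 \<and>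
          liminf (\<lambda>n. ereal (past_prob \<nu>\<^sub>2 (\<phi> n) (B n))) \<le> ereal \<alpha>)) \<and>
     ((\<forall>\<nu>\<^sub>2. torus_law \<nu>\<^sub>2 \<and> case3 \<nu>\<^sub>2 \<longrightarrow>
          limsup (\<lambda>n. ereal (past_prob \<nu>\<^sub>2 (\<phi> n) (B n))) \<le> ereal \<alpha>) \<longrightarrow>
      (\<forall>\<alpha>'. \<alpha> < \<alpha>' \<and> \<alpha>' < 1 \<longrightarrow>
        (\<exists>\<nu>\<^sub>1. torus_law \<nu>\<^sub>1 \<and> (case1 \<nu>\<^sub>1 \<or> case2 \<nu>\<^sub>1) \<and>
            liminf (\<lambda>n. ereal (past_prob \<nu>\<^sub>1 (\<phi> n) (B n))) \<le> ereal \<alpha>')))"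
proof (intro conjI impI allI)
  assume c12: "\<forall>\<nu>\<^sub>1. torus_law \<nu>\<^sub>1 \<and> (case1 \<nu>\<^sub>1 \<or> case2 \<nu>\<^sub>1) \<longrightarrow>
          limsup (\<lambda>n. ereal (past_prob \<nu>\<^sub>1 (\<phi> n) (B n))) \<le> ereal \<alpha>"
  obtain \<nu> where "torus_law \<nu>" "case3 \<nu>" "liminf (\<lambda>n. ereal (past_prob \<nu> (\<phi> n) (B n))) \<le> ereal \<alpha>"
    by (rule case3_law_exists[where B = B and \<phi> = \<phi> and \<beta> = \<alpha>, OF assms(4)]) (simp_all add: c12)
  then show "\<exists>\<nu>\<^sub>2. torus_law \<nu>\<^sub>2 \<and> case3 \<nu>\<^sub>2 \<and>
          liminf (\<lambda>n. ereal (past_prob \<nu>\<^sub>2 (\<phi> n) (B n))) \<le> ereal \<alpha>"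
    by (intro exI[of _ \<nu>] conjI)
next
  fix \<alpha>'
  assume c3: "\<forall>\<nu>\<^sub>2. torus_law \<nu>\<^sub>2 \<and> case3 \<nu>\<^sub>2 \<longrightarrow>
          limsup (\<lambda>n. ereal (past_prob \<nu>\<^sub>2 (\<phi> n) (B n))) \<le> ereal \<alpha>"
    and \<alpha>': "\<alpha> < \<alpha>' \<and> \<alpha>' < 1"
  let ?C = "\<lambda>n. space (\<Pi>\<^sub>M i\<in>{..\<phi> n}. (borel :: torus measure)) - B n"
  show "\<exists>\<nu>\<^sub>1. torus_law \<nu>\<^sub>1 \<and> (case1 \<nu>\<^sub>1 \<or> case2 \<nu>\<^sub>1) \<and>
            liminf (\<lambda>n. ereal (past_prob \<nu>\<^sub>1 (\<phi> n) (B n))) \<le> ereal \<alpha>'"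
  proof (rule ccontr)
    assume no: "\<not> ?thesis"
    \<comment> \<open>If no Case 1 or Case 2 law satisfies the conclusion, each Case 2 law gives
      \<open>B n\<close> probability above \<open>\<alpha>'\<close> eventually, so its complement
      has probability at most \<open>1 - \<alpha>'\<close>.\<close>
    have bound: "limsup (\<lambda>n. ereal (past_prob \<nu> (\<phi> n) (?C n))) \<le> ereal (1 - \<alpha>')"
      if \<nu>: "torus_law \<nu>" "case2 \<nu>" for \<nu>
    proof (rule Limsup_bounded)
      have "ereal \<alpha>' < liminf (\<lambda>n. ereal (past_prob \<nu> (\<phi> n) (B n)))"
        using no \<nu> by (auto simp: not_le)
      from less_LiminfD[OF this]
      show "\<forall>\<^sub>F n in sequentially. ereal (past_prob \<nu> (\<phi> n) (?C n)) \<le> ereal (1 - \<alpha>')"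
        by eventually_elim (simp add: past_prob_Compl[OF \<nu>(1) assms(4)])
    qed
    obtain \<nu> where \<nu>: "torus_law \<nu>" "case3 \<nu>"
      "liminf (\<lambda>n. ereal (past_prob \<nu> (\<phi> n) (?C n))) \<le> ereal (1 - \<alpha>')"
    proof (rule case3_law_exists[where B = ?C and \<phi> = \<phi> and \<beta> = "1 - \<alpha>'"])
      show "?C n \<in> sets (\<Pi>\<^sub>M i\<in>{..\<phi> n}. (borel :: torus measure))" for n
        using assms(4) by (rule sets.compl_sets)
    qed (rule bound)
    \<comment> \<open>The midpoint of \<open>\<alpha>\<close> and \<open>\<alpha>'\<close> separates
      the two bounds: the complements eventually have probability at least
      \<open>1 - (\<alpha> + \<alpha>') / 2\<close>, which exceeds \<open>1 - \<alpha>'\<close> and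
      contradicts the choice of \<open>\<nu>\<close>.\<close>
    have "limsup (\<lambda>n. ereal (past_prob \<nu> (\<phi> n) (B n))) < ereal ((\<alpha> + \<alpha>') / 2)"
      using \<alpha>' by (intro le_less_trans[OF c3[rule_format, OF conjI[OF \<nu>(1,2)]]]) simp
    from Limsup_lessD[OF this]
    have "\<forall>\<^sub>F n in sequentially. ereal (1 - (\<alpha> + \<alpha>') / 2) \<le> ereal (past_prob \<nu> (\<phi> n) (?C n))"
      by eventually_elim (simp add: past_prob_Compl[OF \<nu>(1) assms(4)])
    then have "ereal (1 - (\<alpha> + \<alpha>') / 2) \<le> liminf (\<lambda>n. ereal (past_prob \<nu> (\<phi> n) (?C n)))"
      by (rule Liminf_bounded)
    also note \<nu>(3)
    finally show False
      using \<alpha>' by simp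
  qed
qed

end
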